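(* Let $i\in[1,10]$, and let $\Omega_{3,i}=(B_{3,i},\mathbf x,R_{3,i},\mathbf Z_{3,i})$ and $F_{3,i}$ be the seed and the Laurent polynomial listed in the context. Let $G_{3,i}$ be the group generated by the mutations $\mu_1,\mu_2,\mu_3\in\mathcal S(\Omega_{3,i})$. Then the set of positive integer solutions of the equation $F_{3,i}(\mathbf x)=F_{3,i}(\mathbf 1)$ is exactly the orbit of $\mathbf 1=(1,1,1)$ under $G_{3,i}$, that is, $$G_{3,i}(1,1,1)=\{(x,y,z)\in\mathbb Z_{>0}^3 : F_{3,i}(x,y,z)=F_{3,i}(1,1,1)\}.$$
   Context: Seeds (rank 3). A seed is $\Omega=(B,\mathbf x,R,\mathbf Z)$: $B=(b_{ij})$ a $3\times3$ skew-symmetrizable integer matrix; $\mathbf x=(x_1,x_2,x_3)=(x,y,z)$ free generators of $\mathbb Q(x_1,x_2,x_3)$; $R=\mathrm{diag}(r_1,r_2,r_3)$ with positive integers; $\mathbf Z=(Z_1,Z_2,Z_3)$ with $Z_k(u)=\sum_{i=0}^{r_k}z_{k,i}u^i\in\mathbb Z_{\ge0}[u]$, $z_{k,i}=z_{k,r_k-i}$, $z_{k,0}=z_{k,r_k}=1$. With $B_s=(b_{1s},b_{2s},b_{3s})$ (the $s$-th column) and $[\cdot]_+=\max\{\cdot,0\}$ componentwise, put $P_{\Omega,s}(\mathbf x)=\sum_{i=0}^{r_s}z_{s,i}\mathbf x^{i[B_s]_++(r_s-i)[-B_s]_+}$. The mutation $\mu_s$ changes $B$ to $B'$ with $b'_{ij}=-b_{ij}$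 if $i=s$ or $j=s$ and $b'_{ij}=b_{ij}+r_s([b_{is}]_+b_{sj}+b_{is}[-b_{sj}]_+)$ otherwise, and changes $x_s$ to $P_{\Omega,s}(\mathbf x)/x_s$, keeping the other variables, $R$ and $\mathbf Z$. $\mathcal S(\Omega)$ is the set of all $\sigma\mu_s$ ($\sigma$ a permutation of indices, applied after $\mu_s$) sending $(B,\mathbf x,R,\mathbf Z)$ to $(\pm B,\mathbf x',R,\mathbf Z)$ for some $\mathbf x'$. For the seeds below, $\mu_1,\mu_2,\mu_3\in\mathcal S(\Omega_{3,i})$, and each $\mu_s$ acts on triples as the involutive rational map replacing the $s$-th coordinate $x_s$ by $P_{\Omega_{3,i},s}(\mathbf x)/x_s$; $G_{3,i}$ is the group generated by these three maps. List (matrices written row by row; $R$ given by its diagonal; $k,k_1,k_2,k_3$ denote arbitrary non-negative integers; $Z_j=1+u$ whenever $r_j=1$): $i=1$: $B=[0,2,-2;\,-2,0,2;\,2,-2,0]$, $R=(1,1,1)$; $F=\frac{x^2+y^2+z^2}{xyz}$. $i=2$: $B=[0,2,-1;\,-2,0,1;\,2,-2,0]$, $R=(1,1,2)$, $Z_3=1+k_3u+u^2$; $F=\frac{x^2+y^2+z^2+k_3xy}{xyz}$. $i=3$: $B=[0,2,-1;\,-1,0,1;\,1,-2,0]$, $R=(2,1,2)$, $Z_1=1+k_1u+u^2$, $Z_3=1+k_3u+u^2$; $F=\frac{x^2+y^2+z^2+k_1yz+k_3xy}{xyz}$. $i=4$: $B=[0,1,-1;\,-1,0,1;\,1,-1,0]$,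 $R=(2,2,2)$, $Z_j=1+k_ju+u^2$ for $j=1,2,3$; $F=\frac{x^2+y^2+z^2+k_1yz+k_2zx+k_3xy}{xyz}$. $i=5$: $B=[0,1,-1;\,-4,0,2;\,4,-2,0]$, $R=(1,1,1)$; $F=\frac{x^2+y^4+z^4+2xy^2+2xz^2}{xy^2z^2}$. $i=6$: $B=[0,1,-1;\,-2,0,2;\,2,-2,0]$, $R=(2,1,1)$, $Z_1=1+ku+u^2$; $F=\frac{x^2+y^4+z^4+2xy^2+ky^2z^2+2xz^2}{xy^2z^2}$. $i=7$: $B=[0,1,-1;\,-1,0,2;\,1,-2,0]$, $R=(4,1,1)$, $Z_1=1+k_1u+k_2u^2+k_1u^3+u^4$; $F=\frac{x^2+2x(y^2+z^2)+k_1xyz+z^4Z_1(y/z)}{xy^2z^2}$. $i=8$: $B=[0,4,-4;\,-1,0,2;\,1,-2,0]$, $R=(1,1,1)$; $F=\frac{x^4+y^2+z^2+2yz}{x^2yz}$. $i=9$: $B=[0,2,-4;\,-1,0,2;\,1,-1,0]$, $R=(1,2,1)$, $Z_2=1+k_2u+u^2$; $F=\frac{x^4+k_2x^2z+y^2+z^2+2yz}{x^2yz}$. $i=10$: $B=[0,2,-2;\,-1,0,1;\,1,-1,0]$, $R=(1,2,2)$, $Z_2=1+k_2u+u^2$, $Z_3=1+k_3u+u^2$; $F=\frac{x^4+k_3x^2y+k_2x^2z+y^2+z^2+2yz}{x^2yz}$. *)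

theory Defs
  imports
    "HOL-Analysis.Analysis"
    "HOL-Computational_Algebra.Polynomial_Factorial"
    "HOL-Algebra.Bij"
    "HOL-Algebra.Generated_Groups"
begin

subsection \<open>Seeds of rank 3\<close>

text \<open>The field of rational functions in three variables over the rationals, realised as the
  fraction field of the iterated polynomial ring.\<close>

type_synonym ratfun3 = "rat poly poly poly fract"

definition variables :: "ratfun3 ^ 3" where
  "variables = vector [to_fract [:[:[:0, 1:]:]:], to_fract [:[:0, 1:]:], to_fract [:0, 1:]]"

text \<open>\<open>zpol $ k\<close> is the polynomial \<open>Z\<^sub>k\<close>; the coefficient type \<^typ>\<open>nat\<close> builds in that
  its coefficients are non-negative integers. \<open>rdeg\<close> is the diagonal of \<open>R\<close>.\<close>

record seed =
  exmat :: "int ^ 3 ^ 3"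
  cluster :: "ratfun3 ^ 3"
  rdeg :: "nat ^ 3"
  zpol :: "nat poly ^ 3"

definition skew_symmetrizable :: "int ^ 3 ^ 3 \<Rightarrow> bool" where
  "skew_symmetrizable B \<longleftrightarrow>
     (\<exists>d :: int ^ 3. (\<forall>i. 0 < d $ i) \<and> (\<forall>i j. d $ i * B $ i $ j = - (d $ j * B $ j $ i)))"

text \<open>Evaluation at \<open>x\<close> of a polynomial in three variables; the innermost variable of the iterated
  polynomial type is the first one, as in \<^const>\<open>variables\<close>.\<close>

definition eval3 :: "ratfun3 ^ 3 \<Rightarrow> rat poly poly poly \<Rightarrow> ratfun3" where
  "eval3 x p =
     poly (map_poly (\<lambda>q.
       poly (map_poly (\<lambda>r.
         poly (map_poly (\<lambda>c. to_fract [:[:[:c:]:]:]) r) (x $ 1)) q) (x $ 2)) p) (x $ 3)"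

definition free_generators :: "ratfun3 ^ 3 \<Rightarrow> bool" where
  "free_generators x \<longleftrightarrow>
     inj (eval3 x) \<and> (\<forall>f. \<exists>p q. q \<noteq> 0 \<and> f = eval3 x p / eval3 x q)"

definition is_seed :: "seed \<Rightarrow> bool" where
  "is_seed \<Omega> \<longleftrightarrow>
     skew_symmetrizable (exmat \<Omega>) \<and> free_generators (cluster \<Omega>) \<and>
     (\<forall>k. 0 < rdeg \<Omega> $ k) \<and>
     (\<forall>k. degree (zpol \<Omega> $ k) = rdeg \<Omega> $ k \<and>
          coeff (zpol \<Omega> $ k) 0 = 1 \<and> coeff (zpol \<Omega> $ k) (rdeg \<Omega> $ k) = 1 \<and>
          (\<forall>i\<le>rdeg \<Omega> $ k. coeff (zpol \<Omega> $ k) i = coeff (zpol \<Omega> $ k) (rdeg \<Omega> $ k - i)))"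

subsection \<open>Mutations\<close>

text \<open>In the exponents, \<^const>\<open>nat\<close> is the positive part \<open>[\<cdot>]\<^sub>+\<close>. The formula is stated over an
  arbitrary field, since it is applied both to clusters and to triples of numbers.\<close>

definition exchange_poly :: "seed \<Rightarrow> 3 \<Rightarrow> 'a::field ^ 3 \<Rightarrow> 'a" where
  "exchange_poly \<Omega> s x =
     (\<Sum>i\<le>rdeg \<Omega> $ s. of_nat (coeff (zpol \<Omega> $ s) i) *
        (\<Prod>j\<in>UNIV. x $ j ^ (i * nat (exmat \<Omega> $ j $ s) + (rdeg \<Omega> $ s - i) * nat (- exmat \<Omega> $ j $ s))))"

definition mutate_triple :: "seed \<Rightarrow> 3 \<Rightarrow> 'a::field ^ 3 \<Rightarrow> 'a ^ 3" where
  "mutate_triple \<Omega> s x = (\<chi> j. if j = s then exchange_poly \<Omega> s x / x $ s else x $ j)"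

definition mutate_matrix :: "seed \<Rightarrow> 3 \<Rightarrow> int ^ 3 ^ 3" where
  "mutate_matrix \<Omega> s = (\<chi> i j.
     if i = s \<or> j = s then - exmat \<Omega> $ i $ j
     else exmat \<Omega> $ i $ j + int (rdeg \<Omega> $ s) *
       (max (exmat \<Omega> $ i $ s) 0 * exmat \<Omega> $ s $ j + exmat \<Omega> $ i $ s * max (- exmat \<Omega> $ s $ j) 0))"

definition mutate :: "3 \<Rightarrow> seed \<Rightarrow> seed" where
  "mutate s \<Omega> = \<Omega>\<lparr>exmat := mutate_matrix \<Omega> s, cluster := mutate_triple \<Omega> s (cluster \<Omega>)\<rparr>"

definition permute_seed :: "(3 \<Rightarrow> 3) \<Rightarrow> seed \<Rightarrow> seed" where
  "permute_seed \<sigma> \<Omega> =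
     (let \<tau> = inv_into UNIV \<sigma> in
      \<lparr>exmat = (\<chi> i j. exmat \<Omega> $ \<tau> i $ \<tau> j), cluster = (\<chi> i. cluster \<Omega> $ \<tau> i),
       rdeg = (\<chi> i. rdeg \<Omega> $ \<tau> i), zpol = (\<chi> i. zpol \<Omega> $ \<tau> i)\<rparr>)"

definition cluster_symmetries :: "seed \<Rightarrow> (seed \<Rightarrow> seed) set" where
  "cluster_symmetries \<Omega> = {permute_seed \<sigma> \<circ> mutate s | \<sigma> s.
     bij \<sigma> \<and>
     (\<exists>x'. (permute_seed \<sigma> \<circ> mutate s) \<Omega> = \<Omega>\<lparr>cluster := x'\<rparr> \<or>
           (permute_seed \<sigma> \<circ> mutate s) \<Omega> = \<Omega>\<lparr>exmat := - exmat \<Omega>, cluster := x'\<rparr>)}"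

subsection \<open>The group generated by the three mutations\<close>

text \<open>A mutation of triples is a rational map. Its numerator \<^const>\<open>exchange_poly\<close> has non-negative
  coefficients, so it is defined at every triple of positive rationals and maps it to another such
  triple. Since a rational map of this kind is determined by its values on this Zariski dense set,
  the group of rational maps generated by the mutations is identified with a group of bijections of
  the set of positive rational triples.\<close>

definition positive_triples :: "(rat ^ 3) set" where
  "positive_triples = {x. \<forall>j. 0 < x $ j}"

definition mutation_map :: "seed \<Rightarrow> 3 \<Rightarrow> rat ^ 3 \<Rightarrow> rat ^ 3" where
  "mutation_map \<Omega> s = restrict (mutate_triple \<Omega> s) positive_triples"

definition mutation_group :: "seed \<Rightarrow> (rat ^ 3 \<Rightarrow> rat ^ 3) set" where
  "mutation_group \<Omega> =
     generate (BijGroup positive_triples) {mutation_map \<Omega> 1, mutation_map \<Omega> 2, mutation_map \<Omega> 3}"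

subsection \<open>The ten seeds and Laurent polynomials\<close>

text \<open>The parameters are the coefficients occurring in the polynomials \<open>Z\<^sub>j\<close>; each seed uses only some
  of them.\<close>

definition Omega3 :: "nat \<Rightarrow> nat \<Rightarrow> nat \<Rightarrow> nat \<Rightarrow> nat \<Rightarrow> seed" where
  "Omega3 i k k1 k2 k3 =
    (if i = 1 then
      \<lparr>exmat = vector [vector [0, 2, -2], vector [-2, 0, 2], vector [2, -2, 0]],
       cluster = variables, rdeg = vector [1, 1, 1],
       zpol = vector [[:1, 1:], [:1, 1:], [:1, 1:]]\<rparr>
     else if i = 2 then
      \<lparr>exmat = vector [vector [0, 2, -1], vector [-2, 0, 1], vector [2, -2, 0]],
       cluster = variables, rdeg = vector [1, 1, 2],
       zpol = vector [[:1, 1:], [:1, 1:], [:1, k3, 1:]]\<rparr>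
     else if i = 3 then
      \<lparr>exmat = vector [vector [0, 2, -1], vector [-1, 0, 1], vector [1, -2, 0]],
       cluster = variables, rdeg = vector [2, 1, 2],
       zpol = vector [[:1, k1, 1:], [:1, 1:], [:1, k3, 1:]]\<rparr>
     else if i = 4 then
      \<lparr>exmat = vector [vector [0, 1, -1], vector [-1, 0, 1], vector [1, -1, 0]],
       cluster = variables, rdeg = vector [2, 2, 2],
       zpol = vector [[:1, k1, 1:], [:1, k2, 1:], [:1, k3, 1:]]\<rparr>
     else if i = 5 then
      \<lparr>exmat = vector [vector [0, 1, -1], vector [-4, 0, 2], vector [4, -2, 0]],
       cluster = variables, rdeg = vector [1, 1, 1],
       zpol = vector [[:1, 1:], [:1, 1:], [:1, 1:]]\<rparr>
     else if i = 6 then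
      \<lparr>exmat = vector [vector [0, 1, -1], vector [-2, 0, 2], vector [2, -2, 0]],
       cluster = variables, rdeg = vector [2, 1, 1],
       zpol = vector [[:1, k, 1:], [:1, 1:], [:1, 1:]]\<rparr>
     else if i = 7 then
      \<lparr>exmat = vector [vector [0, 1, -1], vector [-1, 0, 2], vector [1, -2, 0]],
       cluster = variables, rdeg = vector [4, 1, 1],
       zpol = vector [[:1, k1, k2, k1, 1:], [:1, 1:], [:1, 1:]]\<rparr>
     else if i = 8 then
      \<lparr>exmat = vector [vector [0, 4, -4], vector [-1, 0, 2], vector [1, -2, 0]],
       cluster = variables, rdeg = vector [1, 1, 1],
       zpol = vector [[:1, 1:], [:1, 1:], [:1, 1:]]\<rparr>
     else if i = 9 then
      \<lparr>exmat = vector [vector [0, 2, -4], vector [-1, 0, 2], vector [1, -1, 0]],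
       cluster = variables, rdeg = vector [1, 2, 1],
       zpol = vector [[:1, 1:], [:1, k2, 1:], [:1, 1:]]\<rparr>
     else if i = 10 then
      \<lparr>exmat = vector [vector [0, 2, -2], vector [-1, 0, 1], vector [1, -1, 0]],
       cluster = variables, rdeg = vector [1, 2, 2],
       zpol = vector [[:1, 1:], [:1, k2, 1:], [:1, k3, 1:]]\<rparr>
     else undefined)"

definition F3 :: "nat \<Rightarrow> nat \<Rightarrow> nat \<Rightarrow> nat \<Rightarrow> nat \<Rightarrow> 'a::field ^ 3 \<Rightarrow> 'a" where
  "F3 i k k1 k2 k3 v =
    (let x = v $ 1; y = v $ 2; z = v $ 3 in
     if i = 1 then (x^2 + y^2 + z^2) / (x*y*z)
     else if i = 2 then (x^2 + y^2 + z^2 + of_nat k3*x*y) / (x*y*z)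
     else if i = 3 then (x^2 + y^2 + z^2 + of_nat k1*y*z + of_nat k3*x*y) / (x*y*z)
     else if i = 4 then
       (x^2 + y^2 + z^2 + of_nat k1*y*z + of_nat k2*z*x + of_nat k3*x*y) / (x*y*z)
     else if i = 5 then (x^2 + y^4 + z^4 + 2*x*y^2 + 2*x*z^2) / (x*y^2*z^2)
     else if i = 6 then
       (x^2 + y^4 + z^4 + 2*x*y^2 + of_nat k*y^2*z^2 + 2*x*z^2) / (x*y^2*z^2)
     else if i = 7 then
       (x^2 + 2*x*(y^2 + z^2) + of_nat k1*x*y*z
          + z^4 * poly [:1, of_nat k1, of_nat k2, of_nat k1, 1:] (y/z)) / (x*y^2*z^2)
     else if i = 8 then (x^4 + y^2 + z^2 + 2*y*z) / (x^2*y*z)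
     else if i = 9 then (x^4 + of_nat k2*x^2*z + y^2 + z^2 + 2*y*z) / (x^2*y*z)
     else if i = 10 then
       (x^4 + of_nat k3*x^2*y + of_nat k2*x^2*z + y^2 + z^2 + 2*y*z) / (x^2*y*z)
     else undefined)"

subsection \<open>The definitions fit together\<close>

lemma eval3_variables: "eval3 variables p = to_fract p"
proof -
  have 1: "poly (map_poly (\<lambda>c. to_fract [:[:[:c:]:]:]) r) (to_fract [:[:[:0, 1:]:]:])
            = to_fract [:[:r:]:]" for r :: "rat poly"
    by (induction r) (simp_all add: map_poly_pCons flip: to_fract_add to_fract_mult)
  have 2: "poly (map_poly (\<lambda>r. to_fract [:[:r:]:]) q) (to_fract [:[:0, 1:]:]) = to_fract [:q:]"
    for q :: "rat poly poly"
    by (induction q) (simp_all add: map_poly_pCons flip: to_fract_add to_fract_mult)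
  have 3: "poly (map_poly (\<lambda>q. to_fract [:q:]) p) (to_fract [:0, 1:]) = to_fract p"
    for p :: "rat poly poly poly"
    by (induction p) (simp_all add: map_poly_pCons flip: to_fract_add to_fract_mult)
  show ?thesis
    by (simp add: eval3_def variables_def 1 2 3)
qed

lemma free_generators_variables: "free_generators variables"
  unfolding free_generators_def eval3_variables
proof (intro conjI allI)
  show "inj (to_fract :: rat poly poly poly \<Rightarrow> _)"
    by (simp add: inj_def)
  fix f :: ratfun3
  show "\<exists>p q. q \<noteq> 0 \<and> f = to_fract p / to_fract q"
    by (cases f) (auto simp: Fract_conv_to_fract)
qed

lemma Omega3_cases:
  assumes "i \<in> {1..10}"
  shows "i = 1 \<or> i = 2 \<or> i = 3 \<or> i = 4 \<or> i = 5 \<or> i = 6 \<or> i = 7 \<or> i = 8 \<or> i = 9 \<or> i = (10::nat)"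
  using assms unfolding atLeastAtMost_iff by presburger

lemmas Omega3_simps =
  Omega3_def[of 1, simplified rel_simps simp_thms if_True if_False]
  Omega3_def[of 2, simplified rel_simps simp_thms if_True if_False]
  Omega3_def[of 3, simplified rel_simps simp_thms if_True if_False]
  Omega3_def[of 4, simplified rel_simps simp_thms if_True if_False]
  Omega3_def[of 5, simplified rel_simps simp_thms if_True if_False]
  Omega3_def[of 6, simplified rel_simps simp_thms if_True if_False]
  Omega3_def[of 7, simplified rel_simps simp_thms if_True if_False]
  Omega3_def[of 8, simplified rel_simps simp_thms if_True if_False]
  Omega3_def[of 9, simplified rel_simps simp_thms if_True if_False]
  Omega3_def[of 10, simplified rel_simps simp_thms if_True if_False]

lemma is_seed_Omega3:
  assumes "i \<in> {1..10}"
  shows "is_seed (Omega3 i k k1 k2 k3)"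
proof -
  define good where "good = (\<lambda>(Z :: nat poly) r. degree Z = r \<and> coeff Z 0 = 1 \<and> coeff Z r = 1 \<and>
    (\<forall>i\<le>r. coeff Z i = coeff Z (r - i)))"
  have le1: "i \<le> 1 \<longleftrightarrow> i = 0 \<or> i = 1" and le2: "i \<le> 2 \<longleftrightarrow> i = 0 \<or> i = 1 \<or> i = 2"
    and le4: "i \<le> 4 \<longleftrightarrow> i = 0 \<or> i = 1 \<or> i = 2 \<or> i = 3 \<or> i = 4" for i :: nat
    by presburger+
  have good: "good [:1, 1:] 1" "good [:1, a, 1:] 2" "good [:1, a, b, a, 1:] 4" for a b :: nat
    unfolding good_def le1 le2 le4 by (auto simp: eval_nat_numeral)
  have sk: "skew_symmetrizable B"
    if "\<forall>i. 0 < d $ i" "\<forall>i j. d $ i * B $ i $ j = - (d $ j * B $ j $ i)" for d B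
    using that unfolding skew_symmetrizable_def by blast
  have "skew_symmetrizable (exmat (Omega3 i k k1 k2 k3))"
    using Omega3_cases[OF assms]
    apply (elim disjE; simp only: Omega3_simps seed.simps)
             apply (rule sk[of "vector [1, 1, 1]"]; simp add: forall_3)
            apply (rule sk[of "vector [2, 2, 1]"]; simp add: forall_3)
           apply (rule sk[of "vector [1, 2, 1]"]; simp add: forall_3)
          apply (rule sk[of "vector [1, 1, 1]"]; simp add: forall_3)
         apply (rule sk[of "vector [4, 1, 1]"]; simp add: forall_3)
        apply (rule sk[of "vector [2, 1, 1]"]; simp add: forall_3)
       apply (rule sk[of "vector [1, 1, 1]"]; simp add: forall_3)
      apply (rule sk[of "vector [1, 4, 4]"]; simp add: forall_3)
     apply (rule sk[of "vector [1, 2, 4]"]; simp add: forall_3)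
    apply (rule sk[of "vector [1, 2, 2]"]; simp add: forall_3)
    done
  moreover have "cluster (Omega3 i k k1 k2 k3) = variables"
    using Omega3_cases[OF assms] by (elim disjE) (simp_all add: Omega3_simps del: One_nat_def)
  moreover have "(\<forall>l. 0 < rdeg (Omega3 i k k1 k2 k3) $ l)"
    using Omega3_cases[OF assms] by (elim disjE) (simp_all add: Omega3_simps forall_3 del: One_nat_def)
  moreover have "\<forall>l. good (zpol (Omega3 i k k1 k2 k3) $ l) (rdeg (Omega3 i k k1 k2 k3) $ l)"
    using Omega3_cases[OF assms]
    by (elim disjE) (simp_all only: Omega3_simps seed.simps vector_3 forall_3 good simp_thms)
  ultimately show ?thesis
    unfolding is_seed_def good_def using free_generators_variables by metis
qed

lemma mutate_in_cluster_symmetries: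
  assumes "i \<in> {1..10}"
  shows "mutate s \<in> cluster_symmetries (Omega3 i k k1 k2 k3)"
proof -
  let ?\<Omega> = "Omega3 i k k1 k2 k3"
  have "mutate_matrix ?\<Omega> s = - exmat ?\<Omega>"
    using Omega3_cases[OF assms] exhaust_3[of s]
    by (elim disjE) (simp_all add: Omega3_simps mutate_matrix_def vec_eq_iff forall_3 del: One_nat_def)
  moreover have "permute_seed id = id"
    by (simp add: fun_eq_iff permute_seed_def Let_def)
  ultimately show ?thesis
    unfolding cluster_symmetries_def
    by (auto intro!: exI[of _ "id :: 3 \<Rightarrow> 3"] exI[of _ s] simp: mutate_def)
qed

lemma mutate_triple_involution:
  assumes "exmat \<Omega> $ s $ s = 0" "exchange_poly \<Omega> s x \<noteq> 0" "x $ s \<noteq> 0"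
  shows "mutate_triple \<Omega> s (mutate_triple \<Omega> s x) = x"
proof -
  have "exchange_poly \<Omega> s (mutate_triple \<Omega> s x) = exchange_poly \<Omega> s x"
    unfolding exchange_poly_def
    by (intro sum.cong refl arg_cong2[where f = "(*)"] prod.cong)
       (auto simp: mutate_triple_def assms(1))
  then show ?thesis
    using assms(2,3) by (simp add: mutate_triple_def vec_eq_iff)
qed

lemma exchange_poly_pos:
  assumes "is_seed \<Omega>" "x \<in> positive_triples"
  shows "0 < exchange_poly \<Omega> s x"
  unfolding exchange_poly_def
proof (rule sum_pos2[of _ 0])
  have pos: "0 < (\<Prod>j\<in>UNIV. x $ j ^ f j)" for f
    using assms(2) by (intro prod_pos) (simp add: positive_triples_def)
  show "0 < of_nat (coeff (zpol \<Omega> $ s) 0) *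
      (\<Prod>j\<in>UNIV. x $ j ^ (0 * nat (exmat \<Omega> $ j $ s) + (rdeg \<Omega> $ s - 0) * nat (- exmat \<Omega> $ j $ s)))"
    using assms(1) by (intro mult_pos_pos pos) (simp add: is_seed_def)
  show "0 \<le> of_nat (coeff (zpol \<Omega> $ s) i) *
      (\<Prod>j\<in>UNIV. x $ j ^ (i * nat (exmat \<Omega> $ j $ s) + (rdeg \<Omega> $ s - i) * nat (- exmat \<Omega> $ j $ s)))"
    for i
    by (intro mult_nonneg_nonneg of_nat_0_le_iff less_imp_le[OF pos])
qed auto

lemma mutation_map_Bij:
  assumes "is_seed \<Omega>"
  shows "mutation_map \<Omega> s \<in> carrier (BijGroup positive_triples)"
proof -
  have 0: "exmat \<Omega> $ s $ s = 0"
    using assms unfolding is_seed_def skew_symmetrizable_def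
    by (metis less_irrefl mult_eq_0_iff neg_equal_zero)
  have closed: "mutate_triple \<Omega> s x \<in> positive_triples" if "x \<in> positive_triples" for x
    using exchange_poly_pos[OF assms that] that
    by (simp add: positive_triples_def mutate_triple_def)
  have inv: "mutate_triple \<Omega> s (mutate_triple \<Omega> s x) = x" if "x \<in> positive_triples" for x
    using exchange_poly_pos[OF assms that, of s] that
    by (intro mutate_triple_involution 0) (auto simp: positive_triples_def dest: spec[of _ s])
  have "bij_betw (mutate_triple \<Omega> s) positive_triples positive_triples"
    by (rule bij_betw_byWitness[where f' = "mutate_triple \<Omega> s"]) (use closed inv in auto)
  then show ?thesis
    by (simp add: BijGroup_def Bij_def mutation_map_def)
qed

end

theory Submission
  imports Defs
begin

text \<open>Mutations preserve integrality of solutions because a variable and its mutation (for some seeds,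
  their squares) are the two roots of a monic quadratic equation over the other variables, or have a
  sum that is a root of such an equation. Conversely, every solution descends to \<open>(1, 1, 1)\<close>: at a
  solution at which no mutation decreases a coordinate, take the largest coordinate, weighting
  coordinates by their degrees. It lies below the other root as well, so the quadratic is non-negative at
  the second largest coordinate, and comparing coefficients there, with all coordinates at least \<open>1\<close>,
  forces all of them to be \<open>1\<close>. Setting parameters to zero leaves three families: seeds 1 to 4, seeds 5
  to 7, and seeds 8 to 10.\<close>

subsection \<open>Orbits of mutation groups\<close>

lemma mutate_triple_nth [simp]:
  "mutate_triple \<Omega> s v $ j = (if j = s then exchange_poly \<Omega> s v / v $ s else v $ j)"
  by (simp add: mutate_triple_def)

lemma mutate_triple_positive:
  assumes "is_seed \<Omega>" "v \<in> positive_triples"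
  shows "mutate_triple \<Omega> s v \<in> positive_triples"
  using exchange_poly_pos[OF assms] assms(2) by (simp add: positive_triples_def)

lemma mutate_triple_mutate_triple:
  assumes "is_seed \<Omega>" "v \<in> positive_triples"
  shows "mutate_triple \<Omega> s (mutate_triple \<Omega> s v) = v"
proof (rule mutate_triple_involution)
  show "exmat \<Omega> $ s $ s = 0"
    using assms(1) unfolding is_seed_def skew_symmetrizable_def
    by (metis less_irrefl mult_eq_0_iff neg_equal_zero)
  show "exchange_poly \<Omega> s v \<noteq> 0" "v $ s \<noteq> 0"
    using exchange_poly_pos[OF assms, of s] assms(2) by (auto simp: positive_triples_def less_le)
qed

text \<open>Since a mutation is an involution on positive triples, inverses of generators give
  nothing new in inductions over the generated group.\<close>

lemma inv_mutation_map:
  assumes "is_seed \<Omega>"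
  shows "inv\<^bsub>BijGroup positive_triples\<^esub> mutation_map \<Omega> s = mutation_map \<Omega> s"
proof (rule group.inv_equality[OF group_BijGroup _ mutation_map_Bij mutation_map_Bij])
  have "mutation_map \<Omega> s \<in> Bij positive_triples"
    using mutation_map_Bij[OF assms] by (simp add: BijGroup_def)
  then show "mutation_map \<Omega> s \<otimes>\<^bsub>BijGroup positive_triples\<^esub> mutation_map \<Omega> s
      = \<one>\<^bsub>BijGroup positive_triples\<^esub>"
    by (auto simp: BijGroup_def mutation_map_def compose_def fun_eq_iff
        mutate_triple_positive[OF assms] mutate_triple_mutate_triple[OF assms])
qed (use assms in auto)

lemma mutation_map_in_group: "mutation_map \<Omega> s \<in> mutation_group \<Omega>"
  unfolding mutation_group_def using exhaust_3[of s] by (intro generate.incl) auto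

lemma mutation_group_carrier:
  assumes "is_seed \<Omega>"
  shows "mutation_group \<Omega> \<subseteq> Bij positive_triples"
proof -
  have "carrier (BijGroup positive_triples) = Bij positive_triples"
    by (simp add: BijGroup_def)
  then show ?thesis
    unfolding mutation_group_def
    using mutation_map_Bij[OF assms]
      group.generate_incl[OF group_BijGroup[of positive_triples],
        of "{mutation_map \<Omega> 1, mutation_map \<Omega> 2, mutation_map \<Omega> 3}"]
    by simp
qed

lemma mutation_group_mutate:
  assumes "is_seed \<Omega>" "g \<in> mutation_group \<Omega>" "v \<in> positive_triples"
  obtains h where "h \<in> mutation_group \<Omega>" "h v = mutate_triple \<Omega> s (g v)"
proof
  let ?h = "mutation_map \<Omega> s \<otimes>\<^bsub>BijGroup positive_triples\<^esub> g"
  show "?h \<in> mutation_group \<Omega>"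
    using mutation_map_in_group assms(2) unfolding mutation_group_def by (rule generate.eng)
  have "g \<in> Bij positive_triples" "mutation_map \<Omega> s \<in> Bij positive_triples"
    using mutation_group_carrier[OF assms(1)] assms(2) mutation_map_in_group by auto
  moreover from this have "g v \<in> positive_triples"
    using assms(3) by (auto dest: Bij_imp_funcset)
  ultimately show "?h v = mutate_triple \<Omega> s (g v)"
    using assms(3) by (simp add: BijGroup_def compose_def mutation_map_def)
qed

text \<open>Induction on the way a group element is generated: a set stable under the three
  mutations is stable under their inverses, which are the same maps, and hence under all
  products.\<close>

lemma mutation_group_invariant:
  assumes "is_seed \<Omega>" "S \<subseteq> positive_triples"
    and closed: "\<And>v s. v \<in> S \<Longrightarrow> mutate_triple \<Omega> s v \<in> S"
    and "g \<in> mutation_group \<Omega>" "v \<in> S"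
  shows "g v \<in> S"
  using assms(4,5) unfolding mutation_group_def
proof (induction arbitrary: v rule: generate.induct)
  case one
  then show ?case using assms(2) by (auto simp: BijGroup_def)
next
  case (incl h)
  then show ?case using assms(2) closed by (auto simp: mutation_map_def)
next
  case (inv h)
  then show ?case
    using assms(2) closed by (auto simp: inv_mutation_map[OF assms(1)]) (auto simp: mutation_map_def)
next
  case (eng g h)
  have "g \<in> Bij positive_triples" "h \<in> Bij positive_triples"
    using mutation_group_carrier[OF assms(1)] eng.hyps unfolding mutation_group_def by auto
  then have "(g \<otimes>\<^bsub>BijGroup positive_triples\<^esub> h) v = g (h v)"
    using assms(2) eng.prems by (auto simp: BijGroup_def compose_def)
  then show ?case using eng by simp
qed

lemma Ints_ge_1:
  fixes r :: "'a :: linordered_idom"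
  assumes "r \<in> \<int>" "0 < r"
  shows "1 \<le> r"
  using assms by (auto elim!: Ints_cases)

text \<open>The descent principle behind all ten cases, with \<open>P\<close> the equation. Closure
  of the solutions under mutation bounds the orbit from above. Conversely, a solution either admits
  a mutation that decreases a coordinate or is \<open>(1, 1, 1)\<close> by \<open>descent\<close>;
  the inequality there says that the mutated coordinate
  \<open>exchange_poly \<Omega> s v / v $ s\<close> is at least \<open>v $ s\<close>.\<close>

lemma orbit_eq_solutions:
  assumes seed: "is_seed \<Omega>"
    and one: "P (vector [1, 1, 1])"
    and closed: "\<And>v s. \<lbrakk>\<forall>j. v $ j \<in> \<int> \<and> 0 < v $ j; P v\<rbrakk>
      \<Longrightarrow> exchange_poly \<Omega> s v / v $ s \<in> \<int> \<and> P (mutate_triple \<Omega> s v)"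
    and descent: "\<And>v. \<lbrakk>\<forall>j. 1 \<le> v $ j; P v; \<forall>s. (v $ s)\<^sup>2 \<le> exchange_poly \<Omega> s v\<rbrakk>
      \<Longrightarrow> v = vector [1, 1, 1]"
  shows "{g (vector [1, 1, 1]) | g. g \<in> mutation_group \<Omega>} =
    {v :: rat ^ 3. (\<forall>j. v $ j \<in> \<int> \<and> 0 < v $ j) \<and> P v}" (is "?O = ?S")
proof
  have pos: "?S \<subseteq> positive_triples"
    by (auto simp: positive_triples_def)
  have S_closed: "mutate_triple \<Omega> s v \<in> ?S" if "v \<in> ?S" for v s
    using that closed[of v s] mutate_triple_positive[OF seed, of v s] pos
    by (auto simp: positive_triples_def)
  have S_one: "vector [1, 1, 1] \<in> ?S"
    using one by (simp add: forall_3)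
  show "?O \<subseteq> ?S"
    using mutation_group_invariant[OF seed pos S_closed _ S_one] by blast
  show "?S \<subseteq> ?O"
  proof
    fix v assume "v \<in> ?S"
    then show "v \<in> ?O"
    \<comment> \<open>The coordinate sum of a solution is a positive integer; the floor merely turns
      this rational into a natural number usable as a measure.\<close>
    proof (induction "nat \<lfloor>\<Sum>j\<in>UNIV. v $ j\<rfloor>" arbitrary: v rule: less_induct)
      case less
      show ?case
      proof (cases "\<forall>s. (v $ s)\<^sup>2 \<le> exchange_poly \<Omega> s v")
        case True
        have v: "v = vector [1, 1, 1]"
          using less.prems True by (intro descent) (simp_all add: Ints_ge_1)
        have "\<one>\<^bsub>BijGroup positive_triples\<^esub> \<in> mutation_group \<Omega>"
          unfolding mutation_group_def by (rule generate.one)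
        moreover have "v = \<one>\<^bsub>BijGroup positive_triples\<^esub> (vector [1, 1, 1])"
          using S_one pos unfolding v by (simp add: BijGroup_def subset_iff)
        ultimately show ?thesis
          by (intro CollectI exI conjI)
      next
        case False
        then obtain s where s: "exchange_poly \<Omega> s v < (v $ s)\<^sup>2"
          by (auto simp: not_le)
        define v' where "v' = mutate_triple \<Omega> s v"
        have v': "v' \<in> ?S"
          unfolding v'_def using less.prems by (rule S_closed)
        have "v' $ s < v $ s"
          using s less.prems by (simp add: v'_def field_simps power2_eq_square)
        then have "\<forall>j\<in>UNIV. v' $ j \<le> v $ j"
          by (simp add: v'_def)
        then have "(\<Sum>j\<in>UNIV. v' $ j) < (\<Sum>j\<in>UNIV. v $ j)"
          using \<open>v' $ s < v $ s\<close> by (intro sum_strict_mono_ex1) auto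
        moreover have "(\<Sum>j\<in>UNIV. v $ j) \<in> \<int>"
          using less.prems by (simp add: Ints_sum)
        then obtain n where "(\<Sum>j\<in>UNIV. v $ j) = of_int n"
          by (elim Ints_cases)
        moreover have "0 \<le> (\<Sum>j\<in>UNIV. v' $ j)"
          using v' by (intro sum_nonneg) (simp add: less_imp_le)
        ultimately have "nat \<lfloor>\<Sum>j\<in>UNIV. v' $ j\<rfloor> < nat \<lfloor>\<Sum>j\<in>UNIV. v $ j\<rfloor>"
          by (simp add: floor_less_iff flip: zless_nat_eq_int_zless)
        then have "v' \<in> ?O"
          using v' by (rule less.hyps)
        then obtain g where g: "g \<in> mutation_group \<Omega>" "v' = g (vector [1, 1, 1])"
          by auto
        \<comment> \<open>Being an involution, the same mutation leads back from the smaller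
          solution to \<open>v\<close>.\<close>
        have "v = mutate_triple \<Omega> s v'"
          unfolding v'_def using less.prems pos
          by (intro mutate_triple_mutate_triple[OF seed, symmetric]) (rule subsetD)
        moreover obtain h where "h \<in> mutation_group \<Omega>"
            "h (vector [1, 1, 1]) = mutate_triple \<Omega> s v'"
          using mutation_group_mutate[OF seed g(1) subsetD[OF pos S_one], of s] unfolding g(2) .
        ultimately have "h \<in> mutation_group \<Omega>" "v = h (vector [1, 1, 1])"
          by simp_all
        then show ?thesis
          by (intro CollectI exI conjI)
      qed
    qed
  qed
qed

text \<open>A root of a monic polynomial with integer coefficients is an algebraic integer, and a
  rational algebraic integer is an integer.\<close>

lemma Ints_if_quadratic_root:
  fixes q b c :: rat
  assumes "q\<^sup>2 + b * q + c = 0" "b \<in> \<int>" "c \<in> \<int>"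
  shows "q \<in> \<int>"
proof (rule rational_algebraic_int_is_int)
  show "algebraic_int q"
  proof (rule algebraic_int.intros)
    show "lead_coeff [:c, b, 1:] = 1" by simp
    show "\<forall>i. coeff [:c, b, 1:] i \<in> \<int>"
      using assms(2,3) by (auto simp: coeff_pCons split: nat.split)
    show "poly [:c, b, 1:] q = 0"
      using assms(1) by (simp add: algebra_simps power2_eq_square)
  qed
  show "q \<in> \<rat>"
    using Rats_of_rat[of q, where 'a = rat] by (simp add: of_rat_eq_id)
qed

subsection \<open>Generalized Markov equations\<close>

text \<open>The equation \<open>F = F(1, 1, 1)\<close> cleared of denominators;
  \<open>3 + a + b + c\<close> is the value at \<open>(1, 1, 1)\<close>. Each parameter belongs to
  the product of the two variables other than the one in its own position, so rotating the variables
  rotates the parameters.\<close>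

definition markov_eq :: "'a::field \<Rightarrow> 'a \<Rightarrow> 'a \<Rightarrow> 'a \<Rightarrow> 'a \<Rightarrow> 'a \<Rightarrow> bool" where
  "markov_eq a b c x y z \<longleftrightarrow>
     x^2 + y^2 + z^2 + a*y*z + b*z*x + c*x*y = (3 + a + b + c)*x*y*z"

lemma markov_eq_rotate: "markov_eq a b c x y z \<longleftrightarrow> markov_eq b c a y z x"
  unfolding markov_eq_def by (simp add: algebra_simps)

lemma markov_eq_swap: "markov_eq a b c x y z \<longleftrightarrow> markov_eq b a c y x z"
  unfolding markov_eq_def by (simp add: algebra_simps)

text \<open>Vieta: the equation is a monic quadratic in \<open>x\<close> with constant term
  \<open>y^2 + z^2 + a*y*z\<close>, so \<open>x'\<close> is its second root. The sum of the roots
  expresses \<open>x'\<close> as an integer polynomial in the rest, which yields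
  integrality.\<close>

lemma markov_eq_mutate:
  fixes a :: "'a::field"
  assumes "markov_eq a b c x y z" "x \<noteq> 0" "x * x' = y^2 + z^2 + a*y*z"
  shows "x' = (3 + a + b + c)*y*z - b*z - c*y - x" "markov_eq a b c x' y z"
proof -
  have "x * (x + x' - ((3 + a + b + c)*y*z - b*z - c*y)) = 0"
    using assms(1,3) unfolding markov_eq_def by (simp add: algebra_simps power2_eq_square)
  then have s: "x + x' = (3 + a + b + c)*y*z - b*z - c*y"
    using assms(2) by simp
  then show "x' = (3 + a + b + c)*y*z - b*z - c*y - x"
    by algebra
  show "markov_eq a b c x' y z"
    using s assms(3) unfolding markov_eq_def by algebra
qed

text \<open>Viewed as a quadratic in the largest variable \<open>z\<close>, the equation has second
  root \<open>(x^2 + y^2 + c*x*y) / z\<close>, and \<open>min\<close> says that this is at least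
  \<open>z\<close>. Thus \<open>y\<close> lies below both roots and the quadratic is non-negative at
  \<open>y\<close>; written out, its value there is minus a sum of non-negative terms, so all of
  them vanish.\<close>

lemma markov_eq_descent_sorted:
  fixes a :: "'a::linordered_field"
  assumes eq: "markov_eq a b c x y z" and nonneg: "0 \<le> a" "0 \<le> b" "0 \<le> c"
    and le: "1 \<le> x" "x \<le> y" "y \<le> z" and min: "z^2 \<le> x^2 + y^2 + c*x*y"
  shows "x = 1 \<and> y = 1 \<and> z = 1"
proof -
  define f where "f = (\<lambda>t. t^2 + t*(a*y + b*x - (3 + a + b + c)*x*y) + x^2 + y^2 + c*x*y)"
  have "f z = 0"
    using eq unfolding f_def markov_eq_def by (simp add: algebra_simps)
  \<comment> \<open>The factorization of \<open>f\<close> through its two roots, multiplied by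
    \<open>z\<close> to avoid naming the second one.\<close>
  then have "z * f y = (z - y) * (x^2 + y^2 + c*x*y - y*z)"
    unfolding f_def by algebra
  moreover have "y*z \<le> z^2"
    using le by (simp add: power2_eq_square mult_right_mono)
  ultimately have "0 \<le> z * f y"
    using le min by (simp add: mult_nonneg_nonneg)
  then have "0 \<le> f y"
    using le by (simp add: zero_le_mult_iff)
  moreover have "f y = - ((2 + a)*y^2*(x - 1) + (b + c)*x*y*(y - 1) + x*(y^2 - x))"
    unfolding f_def by (simp add: algebra_simps power2_eq_square)
  moreover have "y \<le> y^2"
    using le by (simp add: power2_eq_square)
  moreover have "0 \<le> (2 + a)*y^2*(x - 1)" "0 \<le> (b + c)*x*y*(y - 1)" "0 \<le> x*(y^2 - x)"
    using le nonneg \<open>y \<le> y^2\<close> by simp_all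
  ultimately have "(2 + a)*y^2*(x - 1) = 0" "x*(y^2 - x) = 0"
    by linarith+
  then have xy: "x = 1" "y = 1"
    using le nonneg by (auto simp: add_nonneg_eq_0_iff power2_eq_1_iff)
  \<comment> \<open>The competing root \<open>2 + c\<close> is the mutation of \<open>z = 1\<close>;
    it is the larger root and violates \<open>min\<close>.\<close>
  have "(z - 1) * (z - (2 + c)) = 0"
    using eq unfolding markov_eq_def xy by (simp add: algebra_simps power2_eq_square)
  moreover have "\<not> (2 + c)^2 \<le> 2 + c"
    using nonneg by (simp add: power2_eq_square)
  ultimately show ?thesis
    using min xy by auto
qed

text \<open>Rotation moves the largest variable to the last place, and a swap then sorts the other
  two.\<close>

lemma markov_eq_descent:
  fixes a :: "'a::linordered_field"
  assumes "markov_eq a b c x y z" "0 \<le> a" "0 \<le> b" "0 \<le> c" "1 \<le> x" "1 \<le> y" "1 \<le> z"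
    and "x^2 \<le> y^2 + z^2 + a*y*z" "y^2 \<le> z^2 + x^2 + b*z*x" "z^2 \<le> x^2 + y^2 + c*x*y"
  shows "x = 1 \<and> y = 1 \<and> z = 1"
proof -
  have max_z: "p = 1 \<and> q = 1 \<and> r = 1"
    if "markov_eq d e f p q r" "0 \<le> d" "0 \<le> e" "0 \<le> f" "1 \<le> p" "1 \<le> q"
      "p \<le> r" "q \<le> r" "r^2 \<le> p^2 + q^2 + f*p*q" for d e f p q r :: 'a
  proof (cases "p \<le> q")
    case True
    then show ?thesis
      using that by (intro markov_eq_descent_sorted[of d e f])
  next
    case False
    have "markov_eq e d f q p r"
      using that(1) by (rule markov_eq_swap[THEN iffD1])
    moreover have "r^2 \<le> q^2 + p^2 + f*q*p"
      using that(9) by (simp add: algebra_simps)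
    ultimately have "q = 1 \<and> p = 1 \<and> r = 1"
      using that False by (intro markov_eq_descent_sorted[of e d f]) auto
    then show ?thesis by simp
  qed
  note rotate = markov_eq_rotate[THEN iffD1]
  consider "y \<le> x" "z \<le> x" | "z \<le> y" "x \<le> y" | "x \<le> z" "y \<le> z"
    by linarith
  then show ?thesis
  proof cases
    case 1
    then have "y = 1 \<and> z = 1 \<and> x = 1"
      by (intro max_z[OF rotate[OF assms(1)]] assms)
    then show ?thesis by simp
  next
    case 2
    then have "z = 1 \<and> x = 1 \<and> y = 1"
      by (intro max_z[OF rotate[OF rotate[OF assms(1)]]] assms)
    then show ?thesis by simp
  next
    case 3
    then show ?thesis
      by (intro max_z[OF assms(1)] assms)
  qed
qed

section \<open>Orbits described by generalized Markov equations\<close>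

lemma orbit_markov:
  fixes a b c :: nat
  assumes seed: "is_seed \<Omega>"
    and ex: "\<And>v :: rat ^ 3. exchange_poly \<Omega> 1 v = (v$2)^2 + (v$3)^2 + of_nat a * v$2 * v$3"
      "\<And>v :: rat ^ 3. exchange_poly \<Omega> 2 v = (v$3)^2 + (v$1)^2 + of_nat b * v$3 * v$1"
      "\<And>v :: rat ^ 3. exchange_poly \<Omega> 3 v = (v$1)^2 + (v$2)^2 + of_nat c * v$1 * v$2"
  shows "{g (vector [1, 1, 1]) | g. g \<in> mutation_group \<Omega>} =
    {v :: rat ^ 3. (\<forall>j. v $ j \<in> \<int> \<and> 0 < v $ j) \<and>
       markov_eq (of_nat a) (of_nat b) (of_nat c) (v$1) (v$2) (v$3)}"
proof (rule orbit_eq_solutions[OF seed])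
  let ?one = "vector [1, 1, 1] :: rat ^ 3"
  show "markov_eq (of_nat a) (of_nat b) (of_nat c) (?one $ 1)
      (?one $ 2) (?one $ 3)"
    by (simp add: markov_eq_def)
next
  fix v :: "rat ^ 3"
  assume "\<forall>j. 1 \<le> v $ j" "markov_eq (of_nat a) (of_nat b) (of_nat c) (v$1) (v$2) (v$3)"
    "\<forall>s. (v $ s)\<^sup>2 \<le> exchange_poly \<Omega> s v"
  then show "v = vector [1, 1, 1]"
    using markov_eq_descent[of "of_nat a" "of_nat b" "of_nat c" "v$1" "v$2" "v$3"]
    by (simp add: ex forall_3 vec_eq_iff)
next
  fix v :: "rat ^ 3" and s
  assume int: "\<forall>j. v $ j \<in> \<int> \<and> 0 < v $ j"
    and eq: "markov_eq (of_nat a) (of_nat b) (of_nat c) (v$1) (v$2) (v$3)"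
  define u where "u = exchange_poly \<Omega> s v / v $ s"
  have pos: "v$1 \<noteq> 0" "v$2 \<noteq> 0" "v$3 \<noteq> 0" and ints: "v$1 \<in> \<int>" "v$2 \<in> \<int>" "v$3 \<in> \<int>"
    using int by (auto simp: less_le)
  have u: "v $ s * u = exchange_poly \<Omega> s v"
    using int by (simp add: u_def less_le)
  \<comment> \<open>The rotated equations put the second and the third variable first, where
    \<open>markov_eq_mutate\<close> acts.\<close>
  note eq' = markov_eq_rotate[THEN iffD1, OF eq]
    markov_eq_rotate[THEN iffD1, OF markov_eq_rotate[THEN iffD1, OF eq]]
  consider "s = 1" | "s = 2" | "s = 3"
    using exhaust_3 by blast
  then have "u \<in> \<int> \<and> markov_eq (of_nat a) (of_nat b) (of_nat c)
      (if s = 1 then u else v$1) (if s = 2 then u else v$2) (if s = 3 then u else v$3)"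
  proof cases
    case 1
    then show ?thesis
      using markov_eq_mutate[OF eq pos(1), of u] u ints by (simp add: ex)
  next
    case 2
    then show ?thesis
      using markov_eq_mutate[OF eq'(1) pos(2), of u] u ints
      by (simp add: ex markov_eq_rotate[of "of_nat a"])
  next
    case 3
    then show ?thesis
      using markov_eq_mutate[OF eq'(2) pos(3), of u] u ints
      by (simp add: ex markov_eq_rotate[of "of_nat c"])
  qed
  then show "exchange_poly \<Omega> s v / v $ s \<in> \<int> \<and> markov_eq (of_nat a) (of_nat b) (of_nat c)
      (mutate_triple \<Omega> s v $ 1) (mutate_triple \<Omega> s v $ 2) (mutate_triple \<Omega> s v $ 3)"
    by (auto simp: u_def)
qed

text \<open>The substitution \<open>x \<mapsto> x\<^sup>2\<close> intertwines the mutations of the last three seeds with those of a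
  generalized Markov equation.\<close>

lemma orbit_markov_square:
  fixes b c :: nat
  assumes seed: "is_seed \<Omega>"
    and ex: "\<And>v :: rat ^ 3. exchange_poly \<Omega> 1 v = v$2 + v$3"
      "\<And>v :: rat ^ 3. exchange_poly \<Omega> 2 v = (v$3)^2 + (v$1)^4 + of_nat b * v$3 * (v$1)^2"
      "\<And>v :: rat ^ 3. exchange_poly \<Omega> 3 v = (v$1)^4 + (v$2)^2 + of_nat c * (v$1)^2 * v$2"
  shows "{g (vector [1, 1, 1]) | g. g \<in> mutation_group \<Omega>} =
    {v :: rat ^ 3. (\<forall>j. v $ j \<in> \<int> \<and> 0 < v $ j) \<and>
       markov_eq 2 (of_nat b) (of_nat c) ((v$1)^2) (v$2) (v$3)}"
proof (rule orbit_eq_solutions[OF seed])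
  let ?one = "vector [1, 1, 1] :: rat ^ 3"
  show "markov_eq 2 (of_nat b) (of_nat c) ((?one $ 1)^2)
      (?one $ 2) (?one $ 3)"
    by (simp add: markov_eq_def)
next
  fix v :: "rat ^ 3"
  assume ge: "\<forall>j. 1 \<le> v $ j" and eq: "markov_eq 2 (of_nat b) (of_nat c) ((v$1)^2) (v$2) (v$3)"
    and min: "\<forall>s. (v $ s)\<^sup>2 \<le> exchange_poly \<Omega> s v"
  \<comment> \<open>Squaring the first minimality condition produces the Markov one with first
    parameter 2, the cross coefficient of \<open>(v$2 + v$3)^2\<close>.\<close>
  have "((v$1)^2)^2 \<le> (v$2 + v$3)^2"
    using min ge by (intro power_mono) (auto simp: ex forall_3)
  then have "(v$1)^2 = 1 \<and> v$2 = 1 \<and> v$3 = 1"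
    using min ge
    by (intro markov_eq_descent[OF eq])
       (auto simp: ex forall_3 power2_sum algebra_simps one_le_power simp flip: power_mult)
  then show "v = vector [1, 1, 1]"
    using ge[rule_format, of 1] by (auto simp: vec_eq_iff forall_3 power2_eq_1_iff)
next
  fix v :: "rat ^ 3" and s
  assume int: "\<forall>j. v $ j \<in> \<int> \<and> 0 < v $ j"
    and eq: "markov_eq 2 (of_nat b) (of_nat c) ((v$1)^2) (v$2) (v$3)"
  define u where "u = exchange_poly \<Omega> s v / v $ s"
  have pos: "(v$1)^2 \<noteq> 0" "v$2 \<noteq> 0" "v$3 \<noteq> 0" and ints: "v$1 \<in> \<int>" "v$2 \<in> \<int>" "v$3 \<in> \<int>"
    using int by (auto simp: less_le)
  have u: "v $ s * u = exchange_poly \<Omega> s v"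
    using int by (simp add: u_def less_le)
  note eq' = markov_eq_rotate[THEN iffD1, OF eq]
    markov_eq_rotate[THEN iffD1, OF markov_eq_rotate[THEN iffD1, OF eq]]
  consider "s = 1" | "s = 2" | "s = 3"
    using exhaust_3 by blast
  then have "u \<in> \<int> \<and> markov_eq 2 (of_nat b) (of_nat c)
      ((if s = 1 then u else v$1)^2) (if s = 2 then u else v$2) (if s = 3 then u else v$3)"
  proof cases
    case 1
    have "(v$1)^2 * u^2 = (v$2)^2 + (v$3)^2 + 2 * v$2 * v$3"
      using u by (simp add: 1 ex power2_sum flip: power_mult_distrib)
    note mut = markov_eq_mutate[OF eq pos(1) this]
    \<comment> \<open>Vieta only makes the square integral; since \<open>u\<close> is rational, it
      is then an integer as a root of the monic polynomial \<open>X^2 - u^2\<close>.\<close>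
    have "u^2 \<in> \<int>"
      using mut(1) ints by simp
    then have "u \<in> \<int>"
      by (intro Ints_if_quadratic_root[of u 0 "- (u^2)"]) simp_all
    then show ?thesis
      using mut(2) by (simp add: 1)
  next
    case 2
    then show ?thesis
      using markov_eq_mutate[OF eq'(1) pos(2), of u] u ints
      by (simp add: ex markov_eq_rotate[of 2])
  next
    case 3
    then show ?thesis
      using markov_eq_mutate[OF eq'(2) pos(3), of u] u ints
      by (simp add: ex markov_eq_rotate[of "of_nat c"])
  qed
  then show "exchange_poly \<Omega> s v / v $ s \<in> \<int> \<and> markov_eq 2 (of_nat b) (of_nat c)
      ((mutate_triple \<Omega> s v $ 1)^2) (mutate_triple \<Omega> s v $ 2) (mutate_triple \<Omega> s v $ 3)"
    by (auto simp: u_def)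
qed

subsection \<open>The quartic family\<close>

text \<open>The common form of seeds 5 to 7, again cleared of denominators, with
  \<open>7 + 3*p + q\<close> the value at \<open>(1, 1, 1)\<close>. It is homogeneous on the left
  when \<open>x\<close> has weight 2.\<close>

definition quartic_eq :: "'a::field \<Rightarrow> 'a \<Rightarrow> 'a \<Rightarrow> 'a \<Rightarrow> 'a \<Rightarrow> bool" where
  "quartic_eq p q x y z \<longleftrightarrow>
     x^2 + 2*x*(y^2 + z^2) + p*x*y*z + y^4 + p*y^3*z + q*y^2*z^2 + p*y*z^3 + z^4
       = (7 + 3*p + q)*x*y^2*z^2"

lemma quartic_eq_swap: "quartic_eq p q x y z \<longleftrightarrow> quartic_eq p q x z y"
  unfolding quartic_eq_def by (simp add: algebra_simps)

lemma quartic_eq_mutate_x: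
  fixes p :: "'a::field"
  assumes "quartic_eq p q x y z" "x \<noteq> 0" "x * x' = y^4 + p*y^3*z + q*y^2*z^2 + p*y*z^3 + z^4"
  shows "x' = (7 + 3*p + q)*y^2*z^2 - 2*(y^2 + z^2) - p*y*z - x" "quartic_eq p q x' y z"
proof -
  have "x * (x + x' - ((7 + 3*p + q)*y^2*z^2 - 2*(y^2 + z^2) - p*y*z)) = 0"
    using assms(1,3) unfolding quartic_eq_def by algebra
  then have s: "x + x' = (7 + 3*p + q)*y^2*z^2 - 2*(y^2 + z^2) - p*y*z"
    using assms(2) by simp
  then show "x' = (7 + 3*p + q)*y^2*z^2 - 2*(y^2 + z^2) - p*y*z - x"
    by algebra
  show "quartic_eq p q x' y z"
    using s assms(3) unfolding quartic_eq_def by algebra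
qed

text \<open>Dividing by \<open>y\<^sup>2\<close> turns the equation, a reciprocal quartic in \<open>y\<close>, into a quadratic one in
  \<open>y + y'\<close>.\<close>

lemma quartic_eq_iff_quadratic:
  fixes p :: "'a::field"
  assumes "y \<noteq> 0" "y * y' = x + z^2"
  shows "quartic_eq p q x y z \<longleftrightarrow>
    (y + y')^2 + p*z*(y + y') + ((q - 2)*z^2 - (7 + 3*p + q)*x*z^2) = 0" (is "_ \<longleftrightarrow> ?w = 0")
proof -
  have "x^2 + 2*x*(y^2 + z^2) + p*x*y*z + y^4 + p*y^3*z + q*y^2*z^2 + p*y*z^3 + z^4
      - (7 + 3*p + q)*x*y^2*z^2 = y^2 * ?w"
    using assms(2) by algebra
  then show ?thesis
    unfolding quartic_eq_def using assms(1) by (metis eq_iff_diff_eq_0 mult_eq_0_iff power_not_zero)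
qed

text \<open>The quadratic criterion involves \<open>y\<close> and \<open>y'\<close> only through
  their sum, and the relation \<open>y * y' = x + z^2\<close> is symmetric in them.\<close>

lemma quartic_eq_mutate_y:
  fixes p :: "'a::field"
  assumes "quartic_eq p q x y z" "y \<noteq> 0" "y' \<noteq> 0" "y * y' = x + z^2"
  shows "quartic_eq p q x y' z"
  using assms quartic_eq_iff_quadratic[of y y' x z p q] quartic_eq_iff_quadratic[of y' y x z p q]
  by (simp add: ac_simps)

text \<open>The argument of \<open>markov_eq_descent_sorted\<close> for the quadratic in
  \<open>x\<close>, evaluated at \<open>y^2\<close> because \<open>x\<close> has twice the weight of
  \<open>y\<close>.\<close>

lemma quartic_eq_descent_x:
  fixes p :: "'a::linordered_field"
  assumes eq: "quartic_eq p q x y z" and nonneg: "0 \<le> p" "0 \<le> q"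
    and le: "1 \<le> z" "z \<le> y" "y^2 \<le> x"
    and min: "x^2 \<le> y^4 + p*y^3*z + q*y^2*z^2 + p*y*z^3 + z^4"
  shows "x = 1 \<and> y = 1 \<and> z = 1"
proof -
  define P where "P = y^4 + p*y^3*z + q*y^2*z^2 + p*y*z^3 + z^4"
  define f where "f = (\<lambda>t. t^2 + t*(2*(y^2 + z^2) + p*y*z - (7 + 3*p + q)*y^2*z^2) + P)"
  have y: "1 \<le> y" and x: "1 \<le> x"
    using le one_le_power[of y 2] by linarith+
  have "f x = 0"
    using eq unfolding f_def P_def quartic_eq_def by (simp add: algebra_simps)
  then have "x * f (y^2) = (x - y^2) * (P - y^2*x)"
    unfolding f_def by algebra
  moreover have "y^2*x \<le> x^2"
    using le x by (simp add: power2_eq_square[of x] mult_right_mono)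
  ultimately have "0 \<le> x * f (y^2)"
    using le min by (simp add: P_def mult_nonneg_nonneg)
  then have "0 \<le> f (y^2)"
    using x by (simp add: zero_le_mult_iff)
  moreover have "f (y^2) = - (4*y^4*(z^2 - 1) + (2 + q)*y^2*z^2*(y^2 - 1) + 2*p*y^3*z*(y*z - 1)
      + p*y*z^2*(y^3 - z) + z^2*(y^4 - z^2))"
    unfolding f_def P_def by algebra
  moreover have ones: "1 \<le> y^2" "1 \<le> z^2" "1 \<le> y*z"
    using y le(1) mult_mono[of 1 y 1 z] by (simp_all add: one_le_power)
  moreover have "z \<le> y^3" "z^2 \<le> y^4"
  proof -
    show "z \<le> y^3"
      using power_increasing[of 1 3 y] y le by simp
    have "z^2 \<le> y^2"
      using le by (intro power_mono) auto
    also have "y^2 \<le> y^4"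
      using y by (intro power_increasing) auto
    finally show "z^2 \<le> y^4" .
  qed
  moreover have "0 \<le> 4*y^4*(z^2 - 1)" "0 \<le> (2 + q)*y^2*z^2*(y^2 - 1)" "0 \<le> 2*p*y^3*z*(y*z - 1)"
      "0 \<le> p*y*z^2*(y^3 - z)" "0 \<le> z^2*(y^4 - z^2)"
    using nonneg y le ones \<open>z \<le> y^3\<close> \<open>z^2 \<le> y^4\<close> by simp_all
  ultimately have "4*y^4*(z^2 - 1) = 0" "(2 + q)*y^2*z^2*(y^2 - 1) = 0"
    by linarith+
  then have yz: "y = 1" "z = 1"
    using y le nonneg by (auto simp: add_nonneg_eq_0_iff power2_eq_1_iff)
  \<comment> \<open>As before, the second root is the mutation of \<open>x = 1\<close> and is too
    large for \<open>min\<close>.\<close>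
  have "(x - 1) * (x - (2 + 2*p + q)) = 0"
    using eq unfolding quartic_eq_def yz by (simp add: algebra_simps power2_eq_square)
  moreover have "\<not> (2 + 2*p + q)^2 \<le> 2 + 2*p + q"
    using nonneg by (simp add: power2_eq_square)
  ultimately show ?thesis
    using min yz by auto
qed

text \<open>Here \<open>y^2\<close> is the dominant term. The sum \<open>w = y + y'\<close>
  satisfies a quadratic equation forcing it to be large, while
  \<open>x, z^2 \<le> y^2 \<le> x + z^2\<close> forces it to be small; the two agree only for
  \<open>x = z = 1\<close>.\<close>

lemma quartic_eq_descent_y:
  fixes p :: "'a::linordered_field"
  assumes eq: "quartic_eq p q x y z" and nonneg: "0 \<le> p" "0 \<le> q"
    and le: "1 \<le> x" "1 \<le> z" "z \<le> y" "x \<le> y^2" and min: "y^2 \<le> x + z^2"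
  shows "x = 1 \<and> y = 1 \<and> z = 1"
proof -
  define y' where "y' = (x + z^2) / y"
  define w where "w = y + y'"
  have y: "1 \<le> y" using le by simp
  have yy': "y * y' = x + z^2"
    using y by (simp add: y'_def)
  have y': "0 < y'"
    using y le by (simp add: y'_def add_pos_nonneg)
  have quad: "w^2 + p*z*w + ((q - 2)*z^2 - (7 + 3*p + q)*x*z^2) = 0"
    using quartic_eq_iff_quadratic[OF _ yy'] eq y unfolding w_def by auto
  have z2: "1 \<le> z^2" "z^2 \<le> y^2"
    using le by (auto intro: power_mono one_le_power)
  txt \<open>As a function of \<open>y\<^sup>2\<close>, \<open>w\<^sup>2 = (y\<^sup>2 + M + m)\<^sup>2 / y\<^sup>2\<close> is convex, so on \<open>[M, M + m]\<close> it suffices to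
    bound it at the end points.\<close>
  have bound: "w^2 \<le> 4*M + 5*m" if "M + m = x + z^2" "m \<le> M" "0 \<le> m" "M \<le> y^2" for M m
  proof -
    have "y^2 * w^2 = (y^2 + (M + m))^2"
      unfolding that(1) w_def using yy' by algebra
    also have "\<dots> = y^2 * (4*M + 5*m) + ((y^2 - M)*(y^2 - (M + m)) + m*(M + m - 2*y^2))"
      by algebra
    also have "\<dots> \<le> y^2 * (4*M + 5*m)"
    proof -
      have "(y^2 - M)*(y^2 - (M + m)) \<le> 0"
        using that min by (intro mult_nonneg_nonpos) auto
      moreover have "m*(M + m - 2*y^2) \<le> 0"
        using that by (intro mult_nonneg_nonpos) auto
      ultimately show ?thesis by simp
    qed
    finally show ?thesis
      using y by simp
  qed
  have prod: "x \<le> x*z^2" "z^2 \<le> x*z^2"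
    using le z2 by simp_all
  have w2: "7*x*z^2 \<le> w^2 - 2*z^2 \<Longrightarrow> x = 1 \<and> z = 1" and w9: "w^2 \<le> 9*(x*z^2)"
  proof -
    \<comment> \<open>\<open>bound\<close> is applied with \<open>M\<close> the larger and
      \<open>m\<close> the smaller of \<open>x\<close> and \<open>z^2\<close>.\<close>
    have "w^2 - 2*z^2 \<le> 2*z^2 + 5*x \<and> w^2 \<le> 9*(x*z^2) \<or> w^2 - 2*z^2 \<le> 4*x + 3*z^2 \<and> w^2 \<le> 9*(x*z^2)"
    proof (cases "x \<le> z^2")
      case True
      then have "w^2 \<le> 4*z^2 + 5*x"
        using le z2 by (intro bound) auto
      then show ?thesis using prod by linarith
    next
      case False
      then have "w^2 \<le> 4*x + 5*z^2"
        using le by (intro bound) auto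
      then show ?thesis using prod by linarith
    qed
    moreover have "x = 1 \<and> z = 1" if "(r + s)*x*z^2 \<le> r*x + s*z^2" "0 < r" "0 < s" for r s
    proof -
      have "r*x + s*z^2 - (r + s)*x*z^2 = - (r*(x*(z^2 - 1)) + s*(z^2*(x - 1)))"
        by algebra
      moreover have nn: "0 \<le> r*(x*(z^2 - 1))" "0 \<le> s*(z^2*(x - 1))"
        using that le z2 by simp_all
      ultimately have "r*(x*(z^2 - 1)) = 0" "s*(z^2*(x - 1)) = 0"
        using that(1) by linarith+
      then show ?thesis
        using that le by (auto simp: power2_eq_1_iff)
    qed
    \<comment> \<open>Both pairs of coefficients sum to 7, the constant in
      \<open>7 + 3*p + q\<close>, so the inequality leaves no slack.\<close>
    from this[of 5 2] this[of 4 3]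
    have "7*x*z^2 \<le> 5*x + 2*z^2 \<Longrightarrow> x = 1 \<and> z = 1" "7*x*z^2 \<le> 4*x + 3*z^2 \<Longrightarrow> x = 1 \<and> z = 1"
      by simp_all
    ultimately show "7*x*z^2 \<le> w^2 - 2*z^2 \<Longrightarrow> x = 1 \<and> z = 1" "w^2 \<le> 9*(x*z^2)"
      by linarith+
  qed
  have "w \<le> 3*(x*z)"
  proof (rule power2_le_imp_le)
    have "x * z^2 \<le> x^2 * z^2"
      using le by (intro mult_right_mono) (simp_all add: power2_eq_square)
    then show "w^2 \<le> (3*(x*z))^2"
      using w9 by (simp add: power_mult_distrib)
  qed (use le in simp)
  \<comment> \<open>This and the next bound absorb the parameter terms into \<open>3*p*x*z^2\<close>
    and \<open>q*x*z^2\<close> on the right of the quadratic equation.\<close>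
  then have "p*z*w \<le> p*z*(3*(x*z))"
    using nonneg le by (intro mult_left_mono) auto
  moreover have "q*z^2 \<le> q*(x*z^2)"
    using nonneg prod by (intro mult_left_mono)
  ultimately have "7*x*z^2 \<le> w^2 - 2*z^2"
    using quad by (simp add: algebra_simps power2_eq_square)
  then have xz: "x = 1" "z = 1"
    using w2 by auto
  have "(w - 3) * (w + 3 + p) = 0"
    using quad unfolding xz by (simp add: algebra_simps power2_eq_square)
  moreover have "0 < w"
    using y y' by (simp add: w_def)
  ultimately have "w = 3"
    using nonneg by auto
  then have "y' = 3 - y"
    by (simp add: w_def)
  \<comment> \<open>The values 1 and 2 are exchanged by the mutation, and \<open>min\<close> rules
    out 2.\<close>
  then have "(y - 1) * (y - 2) = 0"
    using yy' unfolding xz \<open>y' = 3 - y\<close> by (simp add: algebra_simps)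
  then show ?thesis
    using min xz by auto
qed

text \<open>Swapping \<open>y\<close> and \<open>z\<close> if necessary gives
  \<open>z \<le> y\<close>; comparing \<open>x\<close> with \<open>y^2\<close> then decides which of
  the two descents applies.\<close>

lemma quartic_eq_descent:
  fixes p :: "'a::linordered_field"
  assumes "quartic_eq p q x y z" "0 \<le> p" "0 \<le> q" "1 \<le> x" "1 \<le> y" "1 \<le> z"
    and "x^2 \<le> y^4 + p*y^3*z + q*y^2*z^2 + p*y*z^3 + z^4" "y^2 \<le> x + z^2" "z^2 \<le> x + y^2"
  shows "x = 1 \<and> y = 1 \<and> z = 1"
proof -
  have sorted: "x = 1 \<and> r = 1 \<and> t = 1"
    if "quartic_eq p q x r t" "1 \<le> t" "t \<le> r" "r^2 \<le> x + t^2"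
      "x^2 \<le> r^4 + p*r^3*t + q*r^2*t^2 + p*r*t^3 + t^4" for r t
  proof (cases "r^2 \<le> x")
    case True
    then show ?thesis
      using that by (intro quartic_eq_descent_x[OF that(1) assms(2,3)])
  next
    case False
    then show ?thesis
      using that assms(4) by (intro quartic_eq_descent_y[OF that(1) assms(2,3)]) simp_all
  qed
  show ?thesis
  proof (cases "z \<le> y")
    case True
    then show ?thesis
      by (intro sorted assms)
  next
    case False
    have "x = 1 \<and> z = 1 \<and> y = 1"
    proof (rule sorted)
      show "quartic_eq p q x z y"
        using assms(1) by (rule quartic_eq_swap[THEN iffD1])
      show "x^2 \<le> z^4 + p*z^3*y + q*z^2*y^2 + p*z*y^3 + y^4"
        using assms(7) by (simp add: algebra_simps)
    qed (use assms False in auto)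
    then show ?thesis by simp
  qed
qed

text \<open>It is \<open>y + y'\<close>, not \<open>y'\<close> itself, that is exhibited as a
  rational root of a monic integer quadratic.\<close>

lemma quartic_eq_mutate_y_Ints:
  fixes p :: rat
  assumes "quartic_eq p q x y z" "y \<noteq> 0" "y * y' = x + z^2"
    and ints: "p \<in> \<int>" "q \<in> \<int>" "x \<in> \<int>" "y \<in> \<int>" "z \<in> \<int>"
  shows "y' \<in> \<int>"
proof -
  have "y + y' \<in> \<int>"
  proof (rule Ints_if_quadratic_root)
    show "(y + y')^2 + p*z*(y + y') + ((q - 2)*z^2 - (7 + 3*p + q)*x*z^2) = 0"
      using quartic_eq_iff_quadratic[OF assms(2,3)] assms(1) by blast
  qed (use ints in simp_all)
  then have "(y + y') - y \<in> \<int>"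
    using ints(4) by (rule Ints_diff)
  then show ?thesis by simp
qed

lemma orbit_quartic:
  fixes p q :: nat
  assumes seed: "is_seed \<Omega>"
    and ex: "\<And>v :: rat ^ 3. exchange_poly \<Omega> 1 v = (v$2)^4 + of_nat p * (v$2)^3 * v$3
        + of_nat q * (v$2)^2 * (v$3)^2 + of_nat p * v$2 * (v$3)^3 + (v$3)^4"
      "\<And>v :: rat ^ 3. exchange_poly \<Omega> 2 v = v$1 + (v$3)^2"
      "\<And>v :: rat ^ 3. exchange_poly \<Omega> 3 v = v$1 + (v$2)^2"
  shows "{g (vector [1, 1, 1]) | g. g \<in> mutation_group \<Omega>} =
    {v :: rat ^ 3. (\<forall>j. v $ j \<in> \<int> \<and> 0 < v $ j) \<and>
       quartic_eq (of_nat p) (of_nat q) (v$1) (v$2) (v$3)}"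
proof (rule orbit_eq_solutions[OF seed])
  let ?one = "vector [1, 1, 1] :: rat ^ 3"
  show "quartic_eq (of_nat p) (of_nat q) (?one $ 1)
      (?one $ 2) (?one $ 3)"
    by (simp add: quartic_eq_def)
next
  fix v :: "rat ^ 3"
  assume "\<forall>j. 1 \<le> v $ j" "quartic_eq (of_nat p) (of_nat q) (v$1) (v$2) (v$3)"
    "\<forall>s. (v $ s)\<^sup>2 \<le> exchange_poly \<Omega> s v"
  then show "v = vector [1, 1, 1]"
    using quartic_eq_descent[of "of_nat p" "of_nat q" "v$1" "v$2" "v$3"]
    by (simp add: ex forall_3 vec_eq_iff)
next
  fix v :: "rat ^ 3" and s
  assume int: "\<forall>j. v $ j \<in> \<int> \<and> 0 < v $ j"
    and eq: "quartic_eq (of_nat p) (of_nat q) (v$1) (v$2) (v$3)"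
  define u where "u = exchange_poly \<Omega> s v / v $ s"
  have pos: "v$1 \<noteq> 0" "v$2 \<noteq> 0" "v$3 \<noteq> 0" and ints: "v$1 \<in> \<int>" "v$2 \<in> \<int>" "v$3 \<in> \<int>"
    using int by (auto simp: less_le)
  have u: "v $ s * u = exchange_poly \<Omega> s v"
    using int by (simp add: u_def less_le)
  \<comment> \<open>In particular \<open>u\<close> is nonzero, as \<open>quartic_eq_mutate_y\<close>
    demands of the new variable.\<close>
  have "0 < u"
    using int exchange_poly_pos[OF seed, of v] by (simp add: u_def positive_triples_def)
  note eq' = quartic_eq_swap[THEN iffD1, OF eq]
  consider "s = 1" | "s = 2" | "s = 3"
    using exhaust_3 by blast
  then have "u \<in> \<int> \<and> quartic_eq (of_nat p) (of_nat q)
      (if s = 1 then u else v$1) (if s = 2 then u else v$2) (if s = 3 then u else v$3)"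
  proof cases
    case 1
    then show ?thesis
      using quartic_eq_mutate_x[OF eq pos(1), of u] u ints by (simp add: ex)
  next
    case 2
    then show ?thesis
      using quartic_eq_mutate_y[OF eq pos(2), of u] quartic_eq_mutate_y_Ints[OF eq pos(2), of u]
        u ints \<open>0 < u\<close> by (simp add: ex)
  next
    case 3
    then show ?thesis
      using quartic_eq_mutate_y[OF eq' pos(3), of u] quartic_eq_mutate_y_Ints[OF eq' pos(3), of u]
        u ints \<open>0 < u\<close> quartic_eq_swap[of _ _ _ _ u] by (simp add: ex)
  qed
  then show "exchange_poly \<Omega> s v / v $ s \<in> \<int> \<and> quartic_eq (of_nat p) (of_nat q)
      (mutate_triple \<Omega> s v $ 1) (mutate_triple \<Omega> s v $ 2) (mutate_triple \<Omega> s v $ 3)"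
    by (auto simp: u_def)
qed

subsection \<open>The ten seeds\<close>

lemma prod_UNIV_3: "(\<Prod>j\<in>UNIV. f j) = f 1 * f 2 * f (3 :: 3)"
  unfolding UNIV_3 by (simp add: mult.assoc)

lemma exchange_poly_Omega3:
  fixes v :: "'a::field ^ 3"
  shows "exchange_poly (Omega3 1 k k1 k2 k3) 1 v = (v$2)^2 + (v$3)^2"
    "exchange_poly (Omega3 1 k k1 k2 k3) 2 v = (v$3)^2 + (v$1)^2"
    "exchange_poly (Omega3 1 k k1 k2 k3) 3 v = (v$1)^2 + (v$2)^2"
    "exchange_poly (Omega3 2 k k1 k2 k3) 1 v = (v$2)^2 + (v$3)^2"
    "exchange_poly (Omega3 2 k k1 k2 k3) 2 v = (v$3)^2 + (v$1)^2"
    "exchange_poly (Omega3 2 k k1 k2 k3) 3 v = (v$1)^2 + (v$2)^2 + of_nat k3 * v$1 * v$2"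
    "exchange_poly (Omega3 3 k k1 k2 k3) 1 v = (v$2)^2 + (v$3)^2 + of_nat k1 * v$2 * v$3"
    "exchange_poly (Omega3 3 k k1 k2 k3) 2 v = (v$3)^2 + (v$1)^2"
    "exchange_poly (Omega3 3 k k1 k2 k3) 3 v = (v$1)^2 + (v$2)^2 + of_nat k3 * v$1 * v$2"
    "exchange_poly (Omega3 4 k k1 k2 k3) 1 v = (v$2)^2 + (v$3)^2 + of_nat k1 * v$2 * v$3"
    "exchange_poly (Omega3 4 k k1 k2 k3) 2 v = (v$3)^2 + (v$1)^2 + of_nat k2 * v$3 * v$1"
    "exchange_poly (Omega3 4 k k1 k2 k3) 3 v = (v$1)^2 + (v$2)^2 + of_nat k3 * v$1 * v$2"
    "exchange_poly (Omega3 5 k k1 k2 k3) 1 v = (v$2)^4 + (v$3)^4"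
    "exchange_poly (Omega3 5 k k1 k2 k3) 2 v = v$1 + (v$3)^2"
    "exchange_poly (Omega3 5 k k1 k2 k3) 3 v = v$1 + (v$2)^2"
    "exchange_poly (Omega3 6 k k1 k2 k3) 1 v = (v$2)^4 + of_nat k * (v$2)^2 * (v$3)^2 + (v$3)^4"
    "exchange_poly (Omega3 6 k k1 k2 k3) 2 v = v$1 + (v$3)^2"
    "exchange_poly (Omega3 6 k k1 k2 k3) 3 v = v$1 + (v$2)^2"
    "exchange_poly (Omega3 7 k k1 k2 k3) 1 v = (v$2)^4 + of_nat k1 * (v$2)^3 * v$3
        + of_nat k2 * (v$2)^2 * (v$3)^2 + of_nat k1 * v$2 * (v$3)^3 + (v$3)^4"
    "exchange_poly (Omega3 7 k k1 k2 k3) 2 v = v$1 + (v$3)^2"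
    "exchange_poly (Omega3 7 k k1 k2 k3) 3 v = v$1 + (v$2)^2"
    "exchange_poly (Omega3 8 k k1 k2 k3) 1 v = v$2 + v$3"
    "exchange_poly (Omega3 8 k k1 k2 k3) 2 v = (v$3)^2 + (v$1)^4"
    "exchange_poly (Omega3 8 k k1 k2 k3) 3 v = (v$1)^4 + (v$2)^2"
    "exchange_poly (Omega3 9 k k1 k2 k3) 1 v = v$2 + v$3"
    "exchange_poly (Omega3 9 k k1 k2 k3) 2 v = (v$3)^2 + (v$1)^4 + of_nat k2 * v$3 * (v$1)^2"
    "exchange_poly (Omega3 9 k k1 k2 k3) 3 v = (v$1)^4 + (v$2)^2"
    "exchange_poly (Omega3 10 k k1 k2 k3) 1 v = v$2 + v$3"
    "exchange_poly (Omega3 10 k k1 k2 k3) 2 v = (v$3)^2 + (v$1)^4 + of_nat k2 * v$3 * (v$1)^2"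
    "exchange_poly (Omega3 10 k k1 k2 k3) 3 v = (v$1)^4 + (v$2)^2 + of_nat k3 * (v$1)^2 * v$2"
  by (simp_all only: exchange_poly_def Omega3_simps seed.simps vector_3 prod_UNIV_3)
     (simp_all add: eval_nat_numeral algebra_simps)

lemma quartic_palindrome_homogenize:
  fixes z :: "'a::field"
  assumes "z \<noteq> 0"
  shows "z^4 * poly [:1, p, q, p, 1:] (y / z) = y^4 + p*y^3*z + q*y^2*z^2 + p*y*z^3 + z^4"
  using assms by (simp add: field_simps eval_nat_numeral)

lemma F3_eq_iff:
  fixes v :: "'a::field_char_0 ^ 3"
  assumes v: "v$1 \<noteq> 0" "v$2 \<noteq> 0" "v$3 \<noteq> 0"
  shows "F3 1 k k1 k2 k3 v = F3 1 k k1 k2 k3 (vector [1, 1, 1]) \<longleftrightarrow> markov_eq 0 0 0 (v$1) (v$2) (v$3)"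
    "F3 2 k k1 k2 k3 v = F3 2 k k1 k2 k3 (vector [1, 1, 1]) \<longleftrightarrow>
      markov_eq 0 0 (of_nat k3) (v$1) (v$2) (v$3)"
    "F3 3 k k1 k2 k3 v = F3 3 k k1 k2 k3 (vector [1, 1, 1]) \<longleftrightarrow>
      markov_eq (of_nat k1) 0 (of_nat k3) (v$1) (v$2) (v$3)"
    "F3 4 k k1 k2 k3 v = F3 4 k k1 k2 k3 (vector [1, 1, 1]) \<longleftrightarrow>
      markov_eq (of_nat k1) (of_nat k2) (of_nat k3) (v$1) (v$2) (v$3)"
    "F3 5 k k1 k2 k3 v = F3 5 k k1 k2 k3 (vector [1, 1, 1]) \<longleftrightarrow> quartic_eq 0 0 (v$1) (v$2) (v$3)"
    "F3 6 k k1 k2 k3 v = F3 6 k k1 k2 k3 (vector [1, 1, 1]) \<longleftrightarrow>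
      quartic_eq 0 (of_nat k) (v$1) (v$2) (v$3)"
    "F3 7 k k1 k2 k3 v = F3 7 k k1 k2 k3 (vector [1, 1, 1]) \<longleftrightarrow>
      quartic_eq (of_nat k1) (of_nat k2) (v$1) (v$2) (v$3)"
    "F3 8 k k1 k2 k3 v = F3 8 k k1 k2 k3 (vector [1, 1, 1]) \<longleftrightarrow>
      markov_eq 2 0 0 ((v$1)^2) (v$2) (v$3)"
    "F3 9 k k1 k2 k3 v = F3 9 k k1 k2 k3 (vector [1, 1, 1]) \<longleftrightarrow>
      markov_eq 2 (of_nat k2) 0 ((v$1)^2) (v$2) (v$3)"
    "F3 10 k k1 k2 k3 v = F3 10 k k1 k2 k3 (vector [1, 1, 1]) \<longleftrightarrow>
      markov_eq 2 (of_nat k2) (of_nat k3) ((v$1)^2) (v$2) (v$3)"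
  unfolding markov_eq_def quartic_eq_def
  by (simp_all only: F3_def Let_def rel_simps if_True if_False vector_3
        quartic_palindrome_homogenize[OF v(3)])
     (simp_all add: v divide_eq_eq algebra_simps)

theorem theorem1p5:
  fixes i k k1 k2 k3 :: nat
  assumes "i \<in> {1..10}"
  shows "{g (vector [1, 1, 1]) | g. g \<in> mutation_group (Omega3 i k k1 k2 k3)} =
    {v :: rat ^ 3. (\<forall>j. v $ j \<in> \<int> \<and> 0 < v $ j) \<and>
       F3 i k k1 k2 k3 v = F3 i k k1 k2 k3 (vector [1, 1, 1])}"
proof -
  note seed = is_seed_Omega3[OF assms, of k k1 k2 k3]
  \<comment> \<open>Positivity of the coordinates supplies the nonvanishing needed to clear
    denominators.\<close>
  have solutions: "{v :: rat ^ 3. (\<forall>j. v $ j \<in> \<int> \<and> 0 < v $ j) \<and>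
        F3 i k k1 k2 k3 v = F3 i k k1 k2 k3 (vector [1, 1, 1])} =
      {v. (\<forall>j. v $ j \<in> \<int> \<and> 0 < v $ j) \<and> Q v}"
    if "\<And>v :: rat ^ 3. \<lbrakk>v$1 \<noteq> 0; v$2 \<noteq> 0; v$3 \<noteq> 0\<rbrakk> \<Longrightarrow>
      F3 i k k1 k2 k3 v = F3 i k k1 k2 k3 (vector [1, 1, 1]) \<longleftrightarrow> Q v" for Q
    using that by (intro Collect_cong) (metis less_irrefl)
  show ?thesis
    using Omega3_cases[OF assms]
  proof (elim disjE)
    assume i: "i = 1"
    show ?thesis
      using orbit_markov[OF seed, of 0 0 0] solutions[of "\<lambda>v. markov_eq 0 0 0 (v$1) (v$2) (v$3)"]
      by (simp add: i exchange_poly_Omega3 F3_eq_iff del: One_nat_def)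
  next
    assume i: "i = 2"
    show ?thesis
      using orbit_markov[OF seed, of 0 0 k3]
        solutions[of "\<lambda>v. markov_eq 0 0 (of_nat k3) (v$1) (v$2) (v$3)"]
      by (simp add: i exchange_poly_Omega3 F3_eq_iff)
  next
    assume i: "i = 3"
    show ?thesis
      using orbit_markov[OF seed, of k1 0 k3]
        solutions[of "\<lambda>v. markov_eq (of_nat k1) 0 (of_nat k3) (v$1) (v$2) (v$3)"]
      by (simp add: i exchange_poly_Omega3 F3_eq_iff)
  next
    assume i: "i = 4"
    show ?thesis
      using orbit_markov[OF seed, of k1 k2 k3]
        solutions[of "\<lambda>v. markov_eq (of_nat k1) (of_nat k2) (of_nat k3) (v$1) (v$2) (v$3)"]
      by (simp add: i exchange_poly_Omega3 F3_eq_iff)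
  next
    assume i: "i = 5"
    show ?thesis
      using orbit_quartic[OF seed, of 0 0] solutions[of "\<lambda>v. quartic_eq 0 0 (v$1) (v$2) (v$3)"]
      by (simp add: i exchange_poly_Omega3 F3_eq_iff)
  next
    assume i: "i = 6"
    show ?thesis
      using orbit_quartic[OF seed, of 0 k]
        solutions[of "\<lambda>v. quartic_eq 0 (of_nat k) (v$1) (v$2) (v$3)"]
      by (simp add: i exchange_poly_Omega3 F3_eq_iff)
  next
    assume i: "i = 7"
    show ?thesis
      using orbit_quartic[OF seed, of k1 k2]
        solutions[of "\<lambda>v. quartic_eq (of_nat k1) (of_nat k2) (v$1) (v$2) (v$3)"]
      by (simp add: i exchange_poly_Omega3 F3_eq_iff)
  next
    assume i: "i = 8"
    show ?thesis
      using orbit_markov_square[OF seed, of 0 0]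
        solutions[of "\<lambda>v. markov_eq 2 0 0 ((v$1)^2) (v$2) (v$3)"]
      by (simp add: i exchange_poly_Omega3 F3_eq_iff)
  next
    assume i: "i = 9"
    show ?thesis
      using orbit_markov_square[OF seed, of k2 0]
        solutions[of "\<lambda>v. markov_eq 2 (of_nat k2) 0 ((v$1)^2) (v$2) (v$3)"]
      by (simp add: i exchange_poly_Omega3 F3_eq_iff)
  next
    assume i: "i = 10"
    show ?thesis
      using orbit_markov_square[OF seed, of k2 k3]
        solutions[of "\<lambda>v. markov_eq 2 (of_nat k2) (of_nat k3) ((v$1)^2) (v$2) (v$3)"]
      by (simp add: i exchange_poly_Omega3 F3_eq_iff)
  qed
qed

end
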